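(* Let $a,b\in\mathbb{R}\setminus\{0\}$ and let $\mathcal{C}\subset\mathbb{CP}^2$ be the complex conic given in the affine chart $\{z=1\}$ by $\frac{x^2}{a}+\frac{y^2}{b}=1$. For $\lambda\in\mathbb{C}\setminus\{a,b\}$ let $\mathcal{C}_\lambda\subset\mathbb{CP}^2$ be the confocal conic given in the same chart by $\frac{x^2}{a-\lambda}+\frac{y^2}{b-\lambda}=1$. Then for any $\lambda\in\mathbb{C}\setminus\{a,b\}$, the confocal conic $\mathcal{C}_\lambda$ is a complex caustic of $\mathcal{C}$.
   Context: Use homogeneous coordinates $(x:y:z)$ on $\mathbb{CP}^2$, identify $\mathbb{C}^2$ with the open set $U_z=\{z=1\}$, let $L_\infty=\{z=0\}$ be the line at infinity, and equip $\mathbb{C}^2$ with the non-degenerate complex quadratic form $q=dx^2+dy^2$. A line of $\mathbb{CP}^2$ is isotropic if it contains $I=(1:i:0)$ or $J=(1:-i:0)$ (so $L_\infty$ is isotropic), and non-isotropic otherwise. Symmetry with respect to a line $L\neq L_\infty$. If $L$ is non-isotropic, the symmetry acting on $\mathbb{C}^2$ is the unique non-trivial complex $q$-isometric involution fixing the points of $L$; it induces a symmetry acting on lines, extended to all lines of $\mathbb{CP}^2$ by sending $L_\infty$ to $L_\infty$. If $L$ is isotropic, the symmetry is defined for lines through a finite point $p\in L\cap U_z$: two lines $\ell,\ell'$ containing $p$ are called symmetric with respect to $L$ if there are sequences of lines $L_n,\ell_n,\ell'_n$ through points $p_n$ such that $L_n$ is non-isotropic, $\ell_n$ and $\ell'_n$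 are symmetric with respect to $L_n$, and $\ell_n\to\ell$, $\ell'_n\to\ell'$, $L_n\to L$, $p_n\to p$. Complex reflection law: at a point $p$ of a conic $C$, a line $\ell$ through $p$ is reflected into a line $\ell'$ through $p$ by the complex reflection law on $C$ if $\ell$ and $\ell'$ are symmetric with respect to the tangent line $T_pC$. Complex caustic: a conic $C'\subset\mathbb{CP}^2$ is a complex caustic of a conic $C\subset\mathbb{CP}^2$ if any line tangent to $C'$ and intersecting $C$ at a certain point $p$ is reflected into a line tangent to $C'$ by the complex reflection law at $p$ on $C$. *)

theory Defs
  imports "HOL-Analysis.Analysis"
begin

section \<open>The complex projective plane and its lines\<close>

definition proportional :: "complex^3 \<Rightarrow> complex^3 \<Rightarrow> bool" where
  "proportional v w \<longleftrightarrow> v \<noteq> 0 \<and> w \<noteq> 0 \<and> (\<exists>c. w = c *s v)"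

lemma proportional_part_equivp: "part_equivp proportional"
proof (rule part_equivpI)
  have "proportional (\<chi> i. 1) (\<chi> i. 1)"
    unfolding proportional_def by (auto simp: vec_eq_iff intro!: exI[of _ 1])
  then show "\<exists>v. proportional v v" ..
  show "symp proportional"
  proof (rule sympI)
    fix v w assume "proportional v w"
    then obtain c where c: "v \<noteq> 0" "w \<noteq> 0" "w = c *s v"
      by (auto simp: proportional_def)
    then have "c \<noteq> 0" by auto
    then have "v = inverse c *s w" using c by simp
    then show "proportional w v" using c(1,2) unfolding proportional_def by blast
  qed
  show "transp proportional"
    by (rule transpI) (auto simp: proportional_def vector_smult_assoc)
qed

quotient_type cp2 = "complex^3" / partial: proportional
  by (rule proportional_part_equivp)

abbreviation proj :: "complex^3 \<Rightarrow> cp2" where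
  "proj v \<equiv> abs_cp2 v"

definition hom :: "complex \<Rightarrow> complex \<Rightarrow> complex \<Rightarrow> cp2" where
  "hom x y z = proj (vector [x, y, z])"

text \<open>The quotient topology of \<open>\<complex>\<^sup>3 - {0}\<close>, which is open in \<open>\<complex>\<^sup>3\<close>.\<close>

instantiation cp2 :: topological_space
begin

definition open_cp2 :: "cp2 set \<Rightarrow> bool" where
  "open_cp2 U \<longleftrightarrow> open {v :: complex^3. v \<noteq> 0 \<and> proj v \<in> U}"

instance
proof
  have "{v :: complex^3. v \<noteq> 0} = - {0}" by auto
  then show "open (UNIV :: cp2 set)"
    by (simp add: open_cp2_def open_Compl)
next
  fix S T :: "cp2 set"
  assume "open S" "open T"
  then have "open ({v :: complex^3. v \<noteq> 0 \<and> proj v \<in> S} \<inter> {v. v \<noteq> 0 \<and> proj v \<in> T})"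
    unfolding open_cp2_def by (rule open_Int)
  also have "{v :: complex^3. v \<noteq> 0 \<and> proj v \<in> S} \<inter> {v. v \<noteq> 0 \<and> proj v \<in> T} =
      {v. v \<noteq> 0 \<and> proj v \<in> S \<inter> T}" by auto
  finally show "open (S \<inter> T)" unfolding open_cp2_def .
next
  fix K :: "cp2 set set"
  assume "\<forall>S\<in>K. open S"
  then have "open (\<Union>S\<in>K. {v :: complex^3. v \<noteq> 0 \<and> proj v \<in> S})"
    unfolding open_cp2_def by (intro open_UN) auto
  also have "(\<Union>S\<in>K. {v :: complex^3. v \<noteq> 0 \<and> proj v \<in> S}) = {v. v \<noteq> 0 \<and> proj v \<in> \<Union>K}"
    by auto
  finally show "open (\<Union>K)" unfolding open_cp2_def .
qed

end

text \<open>The line \<open>\<alpha>x + \<beta>y + \<gamma>z = 0\<close> is represented by the point \<open>(\<alpha>:\<beta>:\<gamma>)\<close> of the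
  dual projective plane; convergence of lines is convergence in the dual plane.\<close>

type_synonym cp2_line = cp2

lift_definition on_line :: "cp2 \<Rightarrow> cp2_line \<Rightarrow> bool"
  is "\<lambda>p l. (\<Sum>i\<in>UNIV. p $ i * l $ i) = 0"
proof -
  fix p p' l l' :: "complex^3"
  assume "proportional p p'" "proportional l l'"
  then obtain c d where p': "p' = c *s p" "p' \<noteq> 0" and l': "l' = d *s l" "l' \<noteq> 0"
    by (auto simp: proportional_def)
  have "c \<noteq> 0" "d \<noteq> 0" using p' l' by auto
  moreover have "(\<Sum>i\<in>UNIV. p' $ i * l' $ i) = c * d * (\<Sum>i\<in>UNIV. p $ i * l $ i)"
    by (simp add: p'(1) l'(1) sum_3 algebra_simps)
  ultimately show "((\<Sum>i\<in>UNIV. p $ i * l $ i) = 0) = ((\<Sum>i\<in>UNIV. p' $ i * l' $ i) = 0)"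
    by simp
qed

definition line_at_infinity :: cp2_line where
  "line_at_infinity = hom 0 0 1"

definition point_I :: cp2 where "point_I = hom 1 \<i> 0"

definition point_J :: cp2 where "point_J = hom 1 (-\<i>) 0"

definition isotropic :: "cp2_line \<Rightarrow> bool" where
  "isotropic l \<longleftrightarrow> on_line point_I l \<or> on_line point_J l"


section \<open>Symmetry with respect to a line\<close>

text \<open>The plane \<open>\<complex>\<^sup>2\<close> is \<^typ>\<open>complex \<times> complex\<close>.\<close>

definition affine_part :: "cp2_line \<Rightarrow> (complex \<times> complex) set" where
  "affine_part l = {(x, y). on_line (hom x y 1) l}"

definition q :: "complex \<times> complex \<Rightarrow> complex" where
  "q u = (fst u)\<^sup>2 + (snd u)\<^sup>2"

definition q_isometric :: "(complex \<times> complex \<Rightarrow> complex \<times> complex) \<Rightarrow> bool" where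
  "q_isometric f \<longleftrightarrow> (\<forall>u v. q (f u - f v) = q (u - v))"

definition is_symmetry :: "cp2_line \<Rightarrow> (complex \<times> complex \<Rightarrow> complex \<times> complex) \<Rightarrow> bool" where
  "is_symmetry L f \<longleftrightarrow>
     q_isometric f \<and> f \<circ> f = id \<and> f \<noteq> id \<and> (\<forall>u\<in>affine_part L. f u = u)"

definition symmetry :: "cp2_line \<Rightarrow> complex \<times> complex \<Rightarrow> complex \<times> complex" where
  "symmetry L = (THE f. is_symmetry L f)"

definition symmetric_lines_nonisotropic :: "cp2_line \<Rightarrow> cp2_line \<Rightarrow> cp2_line \<Rightarrow> bool" where
  "symmetric_lines_nonisotropic L l l' \<longleftrightarrow> \<not> isotropic L \<and>
     (if l = line_at_infinity then l' = line_at_infinity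
      else l' \<noteq> line_at_infinity \<and> affine_part l' = symmetry L ` affine_part l)"

text \<open>The limit definition is used at every point \<open>p\<close> of \<open>L\<close>, not only at the finite ones. An
  isotropic tangent line \<open>L \<noteq> L\<^sub>\<infinity>\<close> of a conic has its contact point at infinity only if
  that point is \<^const>\<open>point_I\<close> or \<^const>\<open>point_J\<close>, as happens for circles.\<close>

definition symmetric_lines_isotropic :: "cp2_line \<Rightarrow> cp2 \<Rightarrow> cp2_line \<Rightarrow> cp2_line \<Rightarrow> bool" where
  "symmetric_lines_isotropic L p l l' \<longleftrightarrow> isotropic L \<and> L \<noteq> line_at_infinity \<and>
     (\<exists>Ln ln ln' pn.
        (\<forall>n::nat. on_line (pn n) (Ln n) \<and> on_line (pn n) (ln n) \<and> on_line (pn n) (ln' n) \<and>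
           \<not> isotropic (Ln n) \<and> symmetric_lines_nonisotropic (Ln n) (ln n) (ln' n)) \<and>
        ln \<longlonglongrightarrow> l \<and> ln' \<longlonglongrightarrow> l' \<and> Ln \<longlonglongrightarrow> L \<and> pn \<longlonglongrightarrow> p)"

definition symmetric_lines :: "cp2_line \<Rightarrow> cp2 \<Rightarrow> cp2_line \<Rightarrow> cp2_line \<Rightarrow> bool" where
  "symmetric_lines L p l l' \<longleftrightarrow> on_line p L \<and> on_line p l \<and> on_line p l' \<and>
     (if isotropic L then symmetric_lines_isotropic L p l l'
      else symmetric_lines_nonisotropic L l l')"


section \<open>Conics, reflection law and caustics\<close>

text \<open>A conic \<open>v\<^sup>T M v = 0\<close> is given by its symmetric matrix \<open>M\<close>; a smooth conic has
  \<open>det M \<noteq> 0\<close>. The gradient of the equation at \<open>v\<close> is \<open>2 M v\<close>, so the tangent line at \<open>v\<close> has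
  the coefficients \<open>M v\<close>.\<close>

definition conic :: "complex^3^3 \<Rightarrow> bool" where
  "conic M \<longleftrightarrow> transpose M = M \<and> det M \<noteq> 0"

lift_definition on_conic :: "cp2 \<Rightarrow> complex^3^3 \<Rightarrow> bool"
  is "\<lambda>v M. (\<Sum>i\<in>UNIV. v $ i * (M *v v) $ i) = 0"
proof -
  fix v w :: "complex^3"
  assume "proportional v w"
  then obtain c where w: "w = c *s v" "w \<noteq> 0"
    by (auto simp: proportional_def)
  have "c \<noteq> 0" using w by auto
  have "(\<Sum>i\<in>UNIV. w $ i * (M *v w) $ i) = c\<^sup>2 * (\<Sum>i\<in>UNIV. v $ i * (M *v v) $ i)"
    for M :: "complex^3^3"
    by (simp add: w(1) sum_3 matrix_vector_mult_def algebra_simps power2_eq_square)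
  then show "(\<lambda>M. (\<Sum>i\<in>UNIV. v $ i * (M *v v) $ i) = 0) =
      (\<lambda>M. (\<Sum>i\<in>UNIV. w $ i * (M *v w) $ i) = 0)"
    using \<open>c \<noteq> 0\<close> by (simp add: fun_eq_iff)
qed

definition tangent_line :: "complex^3^3 \<Rightarrow> cp2 \<Rightarrow> cp2_line" where
  "tangent_line M p = proj (M *v rep_cp2 p)"

definition tangent_to :: "cp2_line \<Rightarrow> complex^3^3 \<Rightarrow> bool" where
  "tangent_to l M \<longleftrightarrow> (\<exists>p. on_conic p M \<and> l = tangent_line M p)"

definition reflected :: "complex^3^3 \<Rightarrow> cp2 \<Rightarrow> cp2_line \<Rightarrow> cp2_line \<Rightarrow> bool" where
  "reflected C p l l' \<longleftrightarrow> on_conic p C \<and> symmetric_lines (tangent_line C p) p l l'"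

text \<open>When the tangent line \<open>L\<close> at \<open>p\<close> is isotropic, \<^const>\<open>symmetric_lines\<close> is a relation and not
  a function: \<open>L\<close> itself has several symmetric lines, not all tangent to \<open>C'\<close>. Hence the existential.\<close>

definition complex_caustic :: "complex^3^3 \<Rightarrow> complex^3^3 \<Rightarrow> bool" where
  "complex_caustic C' C \<longleftrightarrow> conic C' \<and> conic C \<and>
     (\<forall>l p. tangent_to l C' \<and> on_conic p C \<and> on_line p l \<longrightarrow>
        (\<exists>l'. tangent_to l' C' \<and> reflected C p l l'))"

text \<open>The conic with affine equation \<open>x\<^sup>2/\<alpha> + y\<^sup>2/\<beta> = 1\<close>, homogenised to \<open>x\<^sup>2/\<alpha> + y\<^sup>2/\<beta> - z\<^sup>2 = 0\<close>.\<close>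

definition central_conic :: "complex \<Rightarrow> complex \<Rightarrow> complex^3^3" where
  "central_conic \<alpha> \<beta> =
     vector [vector [1/\<alpha>, 0, 0], vector [0, 1/\<beta>, 0], vector [0, 0, -1]]"


section \<open>Well-definedness of the notions above\<close>

lemma vector3_nonzero: "(vector [x, y, z] :: complex^3) \<noteq> 0 \<longleftrightarrow> x \<noteq> 0 \<or> y \<noteq> 0 \<or> z \<noteq> 0"
  by (auto simp: vec_eq_iff forall_3)

lemma proportional_refl: "v \<noteq> 0 \<Longrightarrow> proportional v v"
  by (auto simp: proportional_def intro!: exI[of _ 1])

lemma on_line_proj:
  "v \<noteq> 0 \<Longrightarrow> w \<noteq> 0 \<Longrightarrow> on_line (proj v) (proj w) \<longleftrightarrow> (\<Sum>i\<in>UNIV. v $ i * w $ i) = 0"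
  by (rule on_line.abs_eq) (auto simp: proportional_refl)

lemma on_line_hom:
  assumes "x \<noteq> 0 \<or> y \<noteq> 0 \<or> z \<noteq> 0" "\<alpha> \<noteq> 0 \<or> \<beta> \<noteq> 0 \<or> \<gamma> \<noteq> 0"
  shows "on_line (hom x y z) (hom \<alpha> \<beta> \<gamma>) \<longleftrightarrow> \<alpha> * x + \<beta> * y + \<gamma> * z = 0"
  unfolding hom_def using assms
  by (subst on_line_proj) (auto simp: vector3_nonzero sum_3 mult.commute)

lemma hom_cases:
  obtains x y z where "p = hom x y z" "x \<noteq> 0 \<or> y \<noteq> 0 \<or> z \<noteq> 0"
proof -
  let ?v = "rep_cp2 p"
  have v: "vector [?v $ 1, ?v $ 2, ?v $ 3] = ?v" by (simp add: vec_eq_iff forall_3)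
  have "proportional ?v ?v" by (rule Quotient3_rep_reflp[OF Quotient3_cp2])
  then have "vector [?v $ 1, ?v $ 2, ?v $ 3] \<noteq> (0 :: complex^3)"
    by (simp add: proportional_def v)
  then have nz: "?v $ 1 \<noteq> 0 \<or> ?v $ 2 \<noteq> 0 \<or> ?v $ 3 \<noteq> 0"
    by (simp only: vector3_nonzero)
  have "proj ?v = p" by (rule Quotient3_abs_rep[OF Quotient3_cp2])
  then have "p = hom (?v $ 1) (?v $ 2) (?v $ 3)" by (simp add: hom_def v)
  then show ?thesis using nz by (rule that)
qed

lemma isotropic_hom:
  assumes "\<alpha> \<noteq> 0 \<or> \<beta> \<noteq> 0 \<or> \<gamma> \<noteq> 0"
  shows "isotropic (hom \<alpha> \<beta> \<gamma>) \<longleftrightarrow> \<alpha>\<^sup>2 + \<beta>\<^sup>2 = 0"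
proof -
  have "\<alpha>\<^sup>2 + \<beta>\<^sup>2 = (\<alpha> + \<beta> * \<i>) * (\<alpha> - \<beta> * \<i>)"
    by (simp add: algebra_simps power2_eq_square)
  then show ?thesis using assms
    by (auto simp: isotropic_def point_I_def point_J_def on_line_hom)
qed

lemma symmetry_unique_existence:
  assumes "\<not> isotropic L"
  shows "\<exists>!f. is_symmetry L f"
proof -
  obtain \<alpha> \<beta> \<gamma> where L: "L = hom \<alpha> \<beta> \<gamma>" and nz: "\<alpha> \<noteq> 0 \<or> \<beta> \<noteq> 0 \<or> \<gamma> \<noteq> 0"
    by (rule hom_cases)
  define N where "N = \<alpha>\<^sup>2 + \<beta>\<^sup>2"
  have N: "N \<noteq> 0" using assms nz by (simp add: L isotropic_hom N_def)
  define d where "d u = \<alpha> * fst u + \<beta> * snd u + \<gamma>" for u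
  define R where "R u = (fst u - 2 * d u / N * \<alpha>, snd u - 2 * d u / N * \<beta>)" for u
  have aff: "affine_part L = {u. d u = 0}"
    using nz by (auto simp: affine_part_def L on_line_hom d_def)
  have qR: "q (w - R u) = q (w - u) + 4 * d u * d w / N" for u w
  proof -
    define k where "k = 2 * d u / N"
    have Ru: "R u = (fst u - k * \<alpha>, snd u - k * \<beta>)"
      by (simp add: R_def k_def)
    have "q (w - R u) = q (w - u)
        + 2 * k * (\<alpha> * (fst w - fst u) + \<beta> * (snd w - snd u)) + k * (k * N)"
      by (simp add: q_def Ru N_def power2_eq_square algebra_simps)
    also have "\<alpha> * (fst w - fst u) + \<beta> * (snd w - snd u) = d w - d u"
      by (simp add: d_def algebra_simps)
    also have "k * N = 2 * d u" using N by (simp add: k_def)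
    also have "q (w - u) + 2 * k * (d w - d u) + k * (2 * d u) = q (w - u) + 2 * k * d w"
      by (simp add: algebra_simps)
    finally show ?thesis by (simp add: k_def)
  qed
  have q_commute: "q (u - w) = q (w - u)" for u w
    by (simp add: q_def power2_eq_square algebra_simps)
  have dR: "d (R u) = - d u" for u
  proof -
    define k where "k = 2 * d u / N"
    have Ru: "R u = (fst u - k * \<alpha>, snd u - k * \<beta>)"
      by (simp add: R_def k_def)
    have "d (R u) = d u - k * N"
      by (simp add: d_def Ru N_def power2_eq_square algebra_simps)
    then show ?thesis using N by (simp add: k_def)
  qed
  have RR: "R (R u) = u" for u
    by (simp add: R_def[of "R u"] dR) (simp add: R_def)
  have R_fix: "d u = 0 \<Longrightarrow> R u = u" for u
    by (simp add: R_def)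
  obtain v where v: "d v = 1"
  proof
    have "d ((1 - \<gamma>) / N * \<alpha>, (1 - \<gamma>) / N * \<beta>) = (1 - \<gamma>) / N * N + \<gamma>"
      by (simp only: d_def fst_conv snd_conv N_def power2_eq_square) (simp only: algebra_simps)
    then show "d ((1 - \<gamma>) / N * \<alpha>, (1 - \<gamma>) / N * \<beta>) = 1" using N by simp
  qed
  have "R v \<noteq> v" using dR[of v] v by auto
  have "is_symmetry L R"
    unfolding is_symmetry_def
  proof (intro conjI ballI)
    show "q_isometric R"
      unfolding q_isometric_def
    proof (intro allI)
      fix u w
      have "q (R u - R w) = q (w - R u) + 4 * d w * d (R u) / N"
        by (simp add: qR[of "R u" w] q_commute)
      also have "\<dots> = q (u - w)" by (simp add: qR dR q_commute)
      finally show "q (R u - R w) = q (u - w)" .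
    qed
    show "R \<circ> R = id" by (auto simp: RR)
    show "R \<noteq> id" using \<open>R v \<noteq> v\<close> by (metis id_apply)
    show "R u = u" if "u \<in> affine_part L" for u
      using that by (simp add: aff R_fix)
  qed
  moreover have "f = R" if f: "is_symmetry L f" for f
  proof -
    have iso: "q (f u - f w) = q (u - w)" for u w
      using f unfolding is_symmetry_def q_isometric_def by blast
    have fix_L: "d u = 0 \<Longrightarrow> f u = u" for u
      using f unfolding is_symmetry_def aff by blast
    have dichotomy: "f w = w \<or> f w = R w" for w
    proof -
      obtain e1 e2 where e: "f w = (fst w + e1, snd w + e2)"
        by (metis add_diff_cancel_left' diff_add_cancel prod.collapse add.commute)
      define k where "k = (\<alpha> * e1 + \<beta> * e2) / N"
      define p0 where "p0 = (- \<gamma> / N * \<alpha>, - \<gamma> / N * \<beta>)"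
      define p1 where "p1 = (fst p0 - \<beta>, snd p0 + \<alpha>)"
      have "d p0 = - \<gamma> / N * N + \<gamma>"
        by (simp only: d_def p0_def fst_conv snd_conv N_def power2_eq_square)
          (simp only: algebra_simps)
      then have p0: "d p0 = 0" using N by simp
      then have p1: "d p1 = 0" by (simp add: d_def p1_def algebra_simps)
      have E: "2 * (e1 * (fst w - fst p) + e2 * (snd w - snd p)) + (e1\<^sup>2 + e2\<^sup>2) = 0"
        if "d p = 0" for p
        using iso[of w p] fix_L[OF that] e
        by (simp add: q_def power2_eq_square algebra_simps)
      have orth: "e1 * \<beta> = e2 * \<alpha>"
        using E[OF p0] E[OF p1] by (simp add: p1_def algebra_simps)
      have e1: "e1 = k * \<alpha>" and e2: "e2 = k * \<beta>"
      proof -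
        have "(\<alpha> * e1 + \<beta> * e2) * \<alpha> = e1 * N" "(\<alpha> * e1 + \<beta> * e2) * \<beta> = e2 * N"
          using orth by (simp_all add: N_def power2_eq_square algebra_simps)
        then show "e1 = k * \<alpha>" "e2 = k * \<beta>"
          using N by (simp_all add: k_def)
      qed
      have "\<alpha> * (fst w - fst p0) + \<beta> * (snd w - snd p0) = d w"
        using p0 by (simp add: d_def algebra_simps)
      moreover have "k * (2 * (\<alpha> * (fst w - fst p0) + \<beta> * (snd w - snd p0)) + k * N) = 0"
        using E[OF p0] by (simp add: e1 e2 N_def power2_eq_square algebra_simps)
      ultimately have "k = 0 \<or> k * N = - (2 * d w)"
        by (simp add: add_eq_0_iff)
      then have "k = 0 \<or> k = - (2 * d w / N)"
        using N by (auto simp: field_simps)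
      then show ?thesis
      proof
        assume "k = 0"
        then show ?thesis by (simp add: e e1 e2)
      next
        assume "k = - (2 * d w / N)"
        then have "f w = R w" by (simp add: e e1 e2 R_def)
        then show ?thesis ..
      qed
    qed
    obtain u where u: "f u \<noteq> u" using f by (force simp: is_symmetry_def)
    then have du: "d u \<noteq> 0" "f u = R u" using fix_L dichotomy by blast+
    show "f = R"
    proof
      fix w
      show "f w = R w"
      proof (cases "f w = w")
        case True
        have "q (w - R u) = q (w - u)" using iso[of w u] True du by simp
        then have "d w = 0" using qR[of w u] du N by simp
        then show ?thesis using True by (simp add: R_fix)
      next
        case False
        then show ?thesis using dichotomy by blast
      qed
    qed
  qed
  ultimately show ?thesis by blast
qed

lemma is_symmetry_symmetry: "\<not> isotropic L \<Longrightarrow> is_symmetry L (symmetry L)"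
  unfolding symmetry_def using symmetry_unique_existence by (rule theI')

lemma tangent_line_proj:
  assumes "conic M" "v \<noteq> 0"
  shows "tangent_line M (proj v) = proj (M *v v)"
proof -
  have inv: "invertible M" using assms(1) by (simp add: conic_def invertible_det_nz)
  have nz: "M *v w \<noteq> 0" if "w \<noteq> 0" for w
    using that inv by (metis invertible_def matrix_vector_mul_assoc matrix_vector_mul_lid
        matrix_vector_mult_0_right)
  have "proportional (rep_cp2 (proj v)) v"
    using assms(2) by (intro Quotient3_rep_abs[OF Quotient3_cp2] proportional_refl)
  then have "proportional (M *v rep_cp2 (proj v)) (M *v v)"
    using nz vector_scalar_commute[of M] unfolding proportional_def by metis
  then show ?thesis
    unfolding tangent_line_def by (rule Quotient3_rel_abs[OF Quotient3_cp2])
qed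

lemma conic_central_conic: "\<alpha> \<noteq> 0 \<Longrightarrow> \<beta> \<noteq> 0 \<Longrightarrow> conic (central_conic \<alpha> \<beta>)"
  by (auto simp: conic_def central_conic_def det_3 transpose_def vec_eq_iff forall_3)

lemma on_conic_central_conic:
  "on_conic (hom x y 1) (central_conic \<alpha> \<beta>) \<longleftrightarrow> x\<^sup>2 / \<alpha> + y\<^sup>2 / \<beta> = 1"
proof -
  have "on_conic (hom x y 1) (central_conic \<alpha> \<beta>) \<longleftrightarrow>
      (\<Sum>i\<in>UNIV. (vector [x, y, 1] :: complex^3) $ i *
        (central_conic \<alpha> \<beta> *v vector [x, y, 1]) $ i) = 0"
    unfolding hom_def
    by (subst on_conic.abs_eq) (auto simp: proportional_refl vector3_nonzero)
  then show ?thesis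
    by (simp add: sum_3 matrix_vector_mult_def central_conic_def power2_eq_square)
qed

end

theory Submission
  imports Defs
begin

text \<open>
  The caustic property becomes linear algebra once everything is read in the dual plane. A line is
  a vector \<open>w\<close> of three coefficients, and \<open>\<langle>u, w\<rangle> = u\<^sub>1w\<^sub>1 + u\<^sub>2w\<^sub>2\<close> is the product that \<open>q\<close>
  induces on normal vectors; \<open>w\<close> is isotropic iff \<open>\<langle>w, w\<rangle> = 0\<close>. The tangents of the conic with
  parameters \<open>\<alpha>, \<beta>\<close> are the zeros of the dual form \<open>F(w) = \<alpha>w\<^sub>1\<^sup>2 + \<beta>w\<^sub>2\<^sup>2 - w\<^sub>3\<^sup>2\<close>, and passing to the
  confocal conic replaces \<open>F\<close> by \<open>F - \<mu>\<langle>\<cdot>, \<cdot>\<rangle>\<close>: confocal families are linear pencils of dual forms.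

  Let \<open>t\<close> be the tangent of the first conic at \<open>p\<close>, and let \<open>w\<close> be a line through \<open>p\<close>. For the
  bilinear form of \<open>F\<close>, pairing with \<open>t\<close> is evaluation at \<open>p\<close>, so \<open>F(t, w) = F(t, t) = 0\<close>.
  If \<open>t\<close> is not isotropic, the reflection of \<open>w\<close> in \<open>t\<close> is
  \<open>\<langle>t, t\<rangle>w - 2\<langle>t, w\<rangle>t\<close>. It preserves \<open>\<langle>\<cdot>, \<cdot>\<rangle>\<close> up to the factor \<open>\<langle>t, t\<rangle>\<^sup>2\<close>, and it multiplies \<open>F(w)\<close> by
  the same factor because \<open>t\<close> is \<open>F\<close>-orthogonal to \<open>w\<close> and to itself. So it preserves the zeros of
  \<open>F - \<mu>\<langle>\<cdot>, \<cdot>\<rangle>\<close>, that is, tangency to the confocal conic.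

  If \<open>t\<close> is isotropic, then \<open>F(t) - \<mu>\<langle>t, t\<rangle> = 0\<close>, so \<open>t\<close> itself is tangent to every confocal conic
  (isotropic tangents pass through the common foci), and \<open>t\<close> can serve as the reflected line.
  There are two cases. If \<open>\<langle>t, w\<rangle> \<noteq> 0\<close>, the
  reflections of \<open>w\<close> in the lines \<open>t + \<epsilon>w\<close> through \<open>p\<close> tend to \<open>-2\<langle>t, w\<rangle>t\<close>, which is the line \<open>t\<close>. If
  \<open>\<langle>t, w\<rangle> = 0\<close>, tangency of \<open>w\<close> to the confocal conic forces \<open>w = t\<close> as lines, and \<open>t\<close> is a limit of
  non-isotropic lines, each symmetric to itself with respect to itself.
\<close>

section \<open>Representatives of points and lines\<close>

lemma vector3_components: "(vector [v $ 1, v $ 2, v $ 3] :: complex^3) = v"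
  by (simp add: vec_eq_iff forall_3)

lemma vec3_nonzero_iff: "(v :: complex^3) \<noteq> 0 \<longleftrightarrow> v $ 1 \<noteq> 0 \<or> v $ 2 \<noteq> 0 \<or> v $ 3 \<noteq> 0"
  by (auto simp: vec_eq_iff forall_3)

lemma hom_components: "hom (v $ 1) (v $ 2) (v $ 3) = proj v"
  by (simp add: hom_def vector3_components)

lemma proj_cases:
  obtains v where "p = proj v" "v \<noteq> 0"
  by (metis hom_cases hom_def vector3_nonzero)

lemma proj_smult: "c \<noteq> 0 \<Longrightarrow> v \<noteq> 0 \<Longrightarrow> proj (c *s v) = proj v"
  by (rule Quotient3_rel_abs[OF Quotient3_cp2, symmetric])
    (auto simp: proportional_def)

lemma proj_eq_imp: "v \<noteq> 0 \<Longrightarrow> w \<noteq> 0 \<Longrightarrow> proj v = proj w \<Longrightarrow> \<exists>c. w = c *s v"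
  using Quotient3_rel[OF Quotient3_cp2, of v w]
  by (auto simp: proportional_refl) (auto simp: proportional_def)

lemma proj_eq_line_at_infinity_iff:
  assumes "w \<noteq> 0"
  shows "proj w = line_at_infinity \<longleftrightarrow> w $ 1 = 0 \<and> w $ 2 = 0"
proof
  assume "proj w = line_at_infinity"
  then have "proj (vector [0, 0, 1]) = proj w" by (simp add: line_at_infinity_def hom_def)
  then obtain c where "w = c *s vector [0, 0, 1]"
    using proj_eq_imp[of "vector [0, 0, 1]" w] assms by (auto simp: vector3_nonzero)
  then show "w $ 1 = 0 \<and> w $ 2 = 0" by simp
next
  assume w: "w $ 1 = 0 \<and> w $ 2 = 0"
  then have "w = (w $ 3) *s vector [0, 0, 1]" "w $ 3 \<noteq> 0"
    using assms by (auto simp: vec_eq_iff forall_3)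
  then show "proj w = line_at_infinity"
    by (metis proj_smult line_at_infinity_def hom_def vector3_nonzero zero_neq_one)
qed

lemma tendsto_smult_vec:
  fixes v :: "'a \<Rightarrow> complex^3"
  assumes "(c \<longlongrightarrow> c0) F" "(v \<longlongrightarrow> v0) F"
  shows "((\<lambda>n. c n *s v n) \<longlongrightarrow> c0 *s v0) F"
  by (rule vec_tendstoI) (auto intro!: tendsto_mult tendsto_vec_nth assms)

lemma tendsto_proj:
  assumes "(v \<longlongrightarrow> v0) F" "v0 \<noteq> 0"
  shows "((\<lambda>n. proj (v n)) \<longlongrightarrow> proj v0) F"
proof (rule topological_tendstoI)
  fix U assume "open U" "proj v0 \<in> U"
  then have "\<forall>\<^sub>F n in F. v n \<in> {v. v \<noteq> 0 \<and> proj v \<in> U}"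
    using assms by (intro topological_tendstoD) (auto simp: open_cp2_def)
  then show "\<forall>\<^sub>F n in F. proj (v n) \<in> U" by (rule eventually_mono) simp
qed


section \<open>Reflection of line coordinates\<close>

definition normal_product :: "complex^3 \<Rightarrow> complex^3 \<Rightarrow> complex" where
  "normal_product u w = u $ 1 * w $ 1 + u $ 2 * w $ 2"

lemma isotropic_proj_iff: "w \<noteq> 0 \<Longrightarrow> isotropic (proj w) \<longleftrightarrow> normal_product w w = 0"
  using isotropic_hom[of "w $ 1" "w $ 2" "w $ 3"]
  by (auto simp: hom_components vec3_nonzero_iff normal_product_def power2_eq_square)

text \<open>The orthogonal reflection \<open>u \<mapsto> u - 2 t(u) / \<langle>t, t\<rangle> \<cdot> (t\<^sub>1, t\<^sub>2)\<close> of the affine plane, where \<open>t(u)\<close>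
  is the value at \<open>u\<close> of the affine equation of the line.\<close>

definition affine_reflection :: "complex^3 \<Rightarrow> complex \<times> complex \<Rightarrow> complex \<times> complex" where
  "affine_reflection t u =
     (let k = 2 * (t $ 1 * fst u + t $ 2 * snd u + t $ 3) / normal_product t t
      in (fst u - k * t $ 1, snd u - k * t $ 2))"

lemma affine_part_proj:
  "w \<noteq> 0 \<Longrightarrow> affine_part (proj w) = {u. w $ 1 * fst u + w $ 2 * snd u + w $ 3 = 0}"
  by (auto simp: affine_part_def on_line_hom vec3_nonzero_iff simp flip: hom_components)

text \<open>The symmetry is determined only by its defining properties; the reflection formula has all of
  them, since the value of \<open>t\<close> changes sign under it, so it is the symmetry by uniqueness.\<close>

lemma symmetry_eq_affine_reflection:
  assumes t: "t \<noteq> 0" and N: "normal_product t t \<noteq> 0"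
  shows "symmetry (proj t) = affine_reflection t"
    and "affine_reflection t (affine_reflection t u) = u"
proof -
  define d where "d u = t $ 1 * fst u + t $ 2 * snd u + t $ 3" for u :: "complex \<times> complex"
  define k where "k u = 2 * d u / normal_product t t" for u
  define R where "R = affine_reflection t"
  have R: "R u = (fst u - k u * t $ 1, snd u - k u * t $ 2)" for u
    by (simp add: R_def affine_reflection_def k_def d_def Let_def)
  have kN: "k u * normal_product t t = 2 * d u" for u
    using N by (simp add: k_def)
  have "d (R u) = d u - k u * normal_product t t" for u
    by (simp add: d_def R normal_product_def algebra_simps)
  then have "d (R u) = - d u" for u by (simp add: kN)
  then have "k (R u) = - k u" for u by (simp add: k_def)
  then have RR: "R (R u) = u" for u by (simp add: R[of "R u"]) (simp add: R)
  then show "affine_reflection t (affine_reflection t u) = u" by (simp add: R_def)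
  have "q (R u - R v) = q (u - v)" for u v
  proof -
    define j where "j = k u - k v"
    have "j * normal_product t t = 2 * (d u - d v)"
      unfolding j_def left_diff_distrib kN by simp
    then have j: "j * normal_product t t = 2 * (t $ 1 * (fst u - fst v) + t $ 2 * (snd u - snd v))"
      by (simp add: d_def algebra_simps)
    have "q (R u - R v) = q (u - v)
        + j * (j * normal_product t t - 2 * (t $ 1 * (fst u - fst v) + t $ 2 * (snd u - snd v)))"
      by (simp add: q_def R j_def normal_product_def power2_eq_square algebra_simps)
    then show ?thesis by (simp add: j)
  qed
  \<comment> \<open>The identity would force the affine function \<open>d\<close> to vanish everywhere, hence both of its
    linear coefficients to be zero.\<close>
  moreover have "R \<noteq> id"
  proof
    assume id: "R = id"
    have tn: "t $ 1 \<noteq> 0 \<or> t $ 2 \<noteq> 0" using N by (auto simp: normal_product_def)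
    have d0: "d u = 0" for u
    proof -
      have "k u * t $ 1 = 0 \<and> k u * t $ 2 = 0" using R[of u] unfolding id by (simp add: prod_eq_iff)
      then have "k u = 0" using tn by auto
      then show ?thesis using kN[of u] by simp
    qed
    from d0[of "(0, 0)"] d0[of "(1, 0)"] d0[of "(0, 1)"] tn show False by (auto simp: d_def)
  qed
  moreover have "R u = u" if "u \<in> affine_part (proj t)" for u
    using that t by (simp add: R k_def d_def affine_part_proj)
  ultimately have "is_symmetry (proj t) R"
    unfolding is_symmetry_def q_isometric_def by (auto simp: RR)
  moreover have "\<not> isotropic (proj t)" using t N by (simp add: isotropic_proj_iff)
  ultimately show "symmetry (proj t) = affine_reflection t"
    unfolding R_def using symmetry_unique_existence is_symmetry_symmetry by blast
qed

text \<open>The composite of the equation \<open>w\<close> with the reflection in \<open>t\<close>, multiplied by \<open>\<langle>t, t\<rangle>\<close>. The factor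
  does not change the line, and the resulting polynomial formula remains meaningful when \<open>t\<close>
  tends to an isotropic line.\<close>

definition reflect_line :: "complex^3 \<Rightarrow> complex^3 \<Rightarrow> complex^3" where
  "reflect_line t w = normal_product t t *s w - (2 * normal_product t w) *s t"

lemma reflect_line_involution:
  "reflect_line t (reflect_line t w) = (normal_product t t)\<^sup>2 *s w"
  by (simp add: reflect_line_def normal_product_def vec_eq_iff forall_3 power2_eq_square algebra_simps)

lemma reflect_line_nonzero:
  "normal_product t t \<noteq> 0 \<Longrightarrow> w \<noteq> 0 \<Longrightarrow> reflect_line t w \<noteq> 0"
  using reflect_line_involution[of t w]
  by (auto simp: reflect_line_def[of t 0] normal_product_def[of t 0])

text \<open>By construction, a point lies on the reflected line iff its reflection lies on \<open>w\<close>. The line at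
  infinity has no affine points and has to be followed separately: the reflection of lines fixes
  it, and being an involution up to a factor it sends no other line there.\<close>

lemma symmetric_lines_reflect_line:
  assumes t: "t \<noteq> 0" and N: "normal_product t t \<noteq> 0" and w: "w \<noteq> 0"
  shows "symmetric_lines_nonisotropic (proj t) (proj w) (proj (reflect_line t w))"
proof -
  define w' where "w' = reflect_line t w"
  have w': "w' \<noteq> 0" using reflect_line_nonzero[OF N w] by (simp add: w'_def)
  have finite_iff: "w' $ 1 = 0 \<and> w' $ 2 = 0 \<longleftrightarrow> w $ 1 = 0 \<and> w $ 2 = 0"
  proof
    assume "w' $ 1 = 0 \<and> w' $ 2 = 0"
    then have "normal_product t w' = 0" "w' $ 1 = 0 \<and> w' $ 2 = 0" by (simp_all add: normal_product_def)
    moreover have "reflect_line t w' = (normal_product t t)\<^sup>2 *s w"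
      by (simp add: w'_def reflect_line_involution)
    ultimately show "w $ 1 = 0 \<and> w $ 2 = 0" using N
      by (auto simp: reflect_line_def vec_eq_iff forall_3)
  qed (simp add: w'_def reflect_line_def normal_product_def)
  let ?R = "affine_reflection t"
  have key: "normal_product t t * (w $ 1 * fst (?R u) + w $ 2 * snd (?R u) + w $ 3)
      = w' $ 1 * fst u + w' $ 2 * snd u + w' $ 3" for u
  proof -
    define k where "k = 2 * (t $ 1 * fst u + t $ 2 * snd u + t $ 3) / normal_product t t"
    have kN: "k * normal_product t t = 2 * (t $ 1 * fst u + t $ 2 * snd u + t $ 3)"
      using N by (simp add: k_def)
    have R: "?R u = (fst u - k * t $ 1, snd u - k * t $ 2)"
      by (simp add: affine_reflection_def k_def Let_def)
    have "normal_product t t * (w $ 1 * fst (?R u) + w $ 2 * snd (?R u) + w $ 3)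
      = normal_product t t * (w $ 1 * fst u + w $ 2 * snd u + w $ 3)
        - (k * normal_product t t) * normal_product t w"
      unfolding R by (simp add: normal_product_def[of t w] algebra_simps)
    then show ?thesis unfolding kN by (simp add: w'_def reflect_line_def algebra_simps)
  qed
  have mem: "u \<in> affine_part (proj w') \<longleftrightarrow> ?R u \<in> affine_part (proj w)" for u
    using key[of u] N w w' by (auto simp: affine_part_proj)
  have RR: "?R (?R u) = u" for u by (rule symmetry_eq_affine_reflection(2)[OF t N])
  have "affine_part (proj w') = ?R ` affine_part (proj w)"
  proof (intro equalityI subsetI)
    fix u assume "u \<in> affine_part (proj w')"
    then show "u \<in> ?R ` affine_part (proj w)" using mem RR by (metis image_eqI)
  qed (auto simp: mem RR)
  then show ?thesis
    using t N w w' finite_iff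
    by (simp add: symmetric_lines_nonisotropic_def isotropic_proj_iff
        proj_eq_line_at_infinity_iff symmetry_eq_affine_reflection(1) flip: w'_def)
qed


section \<open>Symmetry with respect to isotropic lines\<close>

text \<open>Limits of lines can be computed on coefficient vectors, as the projection is continuous away
  from zero. It is enough that the conditions hold eventually, because an initial segment of the
  sequences can be dropped. The vectors \<open>w' n\<close> may be rescaled by factors \<open>c\<close> that tend to zero; otherwise
  sequences whose reflected vectors vanish in the limit would be excluded.\<close>

lemma symmetric_lines_isotropicI:
  assumes L: "t0 \<noteq> 0" "w0 \<noteq> 0" "w0' \<noteq> 0" "v0 \<noteq> 0" "isotropic (proj t0)" "proj t0 \<noteq> line_at_infinity"
    and lim: "t \<longlonglongrightarrow> t0" "w \<longlonglongrightarrow> w0" "w' \<longlonglongrightarrow> w0'" "v \<longlonglongrightarrow> v0"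
    and sym: "\<forall>\<^sub>F n in sequentially.
      (\<Sum>i\<in>UNIV. v n $ i * t n $ i) = 0 \<and> (\<Sum>i\<in>UNIV. v n $ i * w n $ i) = 0 \<and>
      normal_product (t n) (t n) \<noteq> 0 \<and> (\<exists>c. c \<noteq> 0 \<and> reflect_line (t n) (w n) = c *s w' n)"
  shows "symmetric_lines_isotropic (proj t0) (proj v0) (proj w0) (proj w0')"
proof -
  have "\<forall>\<^sub>F n in sequentially. t n \<noteq> 0 \<and> w n \<noteq> 0 \<and> v n \<noteq> 0"
    by (intro eventually_conj tendsto_imp_eventually_ne[OF lim(1)]
        tendsto_imp_eventually_ne[OF lim(2)] tendsto_imp_eventually_ne[OF lim(4)] L)
  from eventually_conj[OF this sym] obtain k where k: "\<forall>n\<ge>k.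
      (t n \<noteq> 0 \<and> w n \<noteq> 0 \<and> v n \<noteq> 0) \<and>
      (\<Sum>i\<in>UNIV. v n $ i * t n $ i) = 0 \<and> (\<Sum>i\<in>UNIV. v n $ i * w n $ i) = 0 \<and>
      normal_product (t n) (t n) \<noteq> 0 \<and> (\<exists>c. c \<noteq> 0 \<and> reflect_line (t n) (w n) = c *s w' n)"
    unfolding eventually_sequentially by (rule exE)
  have "on_line (proj (v n)) (proj (t n)) \<and> on_line (proj (v n)) (proj (w n)) \<and>
      on_line (proj (v n)) (proj (w' n)) \<and> \<not> isotropic (proj (t n)) \<and>
      symmetric_lines_nonisotropic (proj (t n)) (proj (w n)) (proj (w' n))" if nk: "n \<ge> k" for n
  proof -
    obtain c where nz: "t n \<noteq> 0" "w n \<noteq> 0" "v n \<noteq> 0"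
      and on: "(\<Sum>i\<in>UNIV. v n $ i * t n $ i) = 0" "(\<Sum>i\<in>UNIV. v n $ i * w n $ i) = 0"
      and N: "normal_product (t n) (t n) \<noteq> 0"
      and c: "c \<noteq> 0" "reflect_line (t n) (w n) = c *s w' n"
      using k[rule_format, OF nk] by (elim conjE exE) (rule that)
    have r: "reflect_line (t n) (w n) \<noteq> 0" by (rule reflect_line_nonzero[OF N nz(2)])
    have w': "w' n \<noteq> 0" using c(2) r by auto
    have same: "proj (reflect_line (t n) (w n)) = proj (w' n)" unfolding c(2) by (rule proj_smult[OF c(1) w'])
    have sym_n: "symmetric_lines_nonisotropic (proj (t n)) (proj (w n)) (proj (reflect_line (t n) (w n)))"
      by (rule symmetric_lines_reflect_line[OF nz(1) N nz(2)])
    have "(\<Sum>i\<in>UNIV. v n $ i * reflect_line (t n) (w n) $ i)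
       = normal_product (t n) (t n) * (\<Sum>i\<in>UNIV. v n $ i * w n $ i)
         - 2 * normal_product (t n) (w n) * (\<Sum>i\<in>UNIV. v n $ i * t n $ i)"
      by (simp add: reflect_line_def sum_3 algebra_simps)
    then have "(\<Sum>i\<in>UNIV. v n $ i * reflect_line (t n) (w n) $ i) = 0" using on by simp
    then have "on_line (proj (v n)) (proj (reflect_line (t n) (w n)))"
      using nz r by (simp add: on_line_proj)
    then show ?thesis
      using nz on N sym_n unfolding same by (simp add: on_line_proj isotropic_proj_iff)
  qed
  then have all_n: "\<forall>n. on_line (proj (v (n + k))) (proj (t (n + k))) \<and>
      on_line (proj (v (n + k))) (proj (w (n + k))) \<and>
      on_line (proj (v (n + k))) (proj (w' (n + k))) \<and> \<not> isotropic (proj (t (n + k))) \<and>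
      symmetric_lines_nonisotropic (proj (t (n + k))) (proj (w (n + k))) (proj (w' (n + k)))"
    by (meson le_add2)
  have conv: "(\<lambda>n. proj (x (n + k))) \<longlonglongrightarrow> proj x0" if "x \<longlonglongrightarrow> x0" "x0 \<noteq> 0" for x x0
    by (intro tendsto_proj LIMSEQ_ignore_initial_segment that)
  show ?thesis
    unfolding symmetric_lines_isotropic_def
    by (rule conjI, rule L(5), rule conjI, rule L(6))
      (rule exI[of _ "\<lambda>n. proj (t (n + k))"], rule exI[of _ "\<lambda>n. proj (w (n + k))"],
       rule exI[of _ "\<lambda>n. proj (w' (n + k))"], rule exI[of _ "\<lambda>n. proj (v (n + k))"],
       intro conjI all_n conv lim L)
qed

lemma tendsto_complex_inverse_Suc: "(\<lambda>n. complex_of_real (inverse (real (Suc n)))) \<longlonglongrightarrow> 0"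
  using tendsto_of_real[OF LIMSEQ_inverse_real_of_nat, where 'a = complex] by simp

text \<open>For isotropic \<open>t\<close>, the square of \<open>t + \<epsilon>m\<close> is \<open>\<epsilon>(2\<langle>t, m\<rangle> + \<epsilon>\<langle>m, m\<rangle>)\<close>, whose second factor is nonzero
  for small \<open>\<epsilon>\<close>: the pencil supplies non-isotropic lines approaching \<open>t\<close>.\<close>

lemma normal_product_pencil_eventually_nonzero:
  assumes "normal_product t t = 0" "normal_product t m \<noteq> 0"
  shows "\<forall>\<^sub>F n in sequentially.
    normal_product (t + complex_of_real (inverse (real (Suc n))) *s m)
      (t + complex_of_real (inverse (real (Suc n))) *s m) \<noteq> 0"
proof -
  define e where "e n = complex_of_real (inverse (real (Suc n)))" for n
  have e: "e \<longlonglongrightarrow> 0" unfolding e_def by (rule tendsto_complex_inverse_Suc)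
  have "(\<lambda>n. 2 * normal_product t m + e n * normal_product m m)
      \<longlonglongrightarrow> 2 * normal_product t m + 0 * normal_product m m"
    by (intro tendsto_intros e)
  then have "\<forall>\<^sub>F n in sequentially. 2 * normal_product t m + e n * normal_product m m \<noteq> 0"
    by (rule tendsto_imp_eventually_ne) (use assms in simp)
  then show ?thesis
    unfolding e_def[symmetric]
  proof (rule eventually_mono)
    fix n assume *: "2 * normal_product t m + e n * normal_product m m \<noteq> 0"
    have "normal_product (t + e n *s m) (t + e n *s m)
       = normal_product t t + e n * (2 * normal_product t m + e n * normal_product m m)"
      by (simp add: normal_product_def algebra_simps)
    moreover have "e n \<noteq> 0" by (simp add: e_def del: of_nat_Suc)
    ultimately show "normal_product (t + e n *s m) (t + e n *s m) \<noteq> 0"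
      using * assms by simp
  qed
qed

text \<open>Reflecting the fixed line \<open>w\<close> in the lines \<open>t + \<epsilon>w\<close>, all through the fixed point \<open>v\<close>, gives lines
  whose coefficients tend to \<open>\<langle>t, t\<rangle>w - 2\<langle>t, w\<rangle>t = -2\<langle>t, w\<rangle>t\<close>.\<close>

lemma isotropic_line_symmetric_to_transversal:
  assumes nz: "t \<noteq> 0" "w \<noteq> 0" "v \<noteq> 0"
    and iso: "normal_product t t = 0" and tr: "normal_product t w \<noteq> 0"
    and inc: "(\<Sum>i\<in>UNIV. v $ i * t $ i) = 0" "(\<Sum>i\<in>UNIV. v $ i * w $ i) = 0"
  shows "symmetric_lines_isotropic (proj t) (proj v) (proj w) (proj t)"
proof -
  define e where "e n = complex_of_real (inverse (real (Suc n)))" for n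
  have e: "e \<longlonglongrightarrow> 0" unfolding e_def by (rule tendsto_complex_inverse_Suc)
  have nonzero: "\<forall>\<^sub>F n in sequentially. normal_product (t + e n *s w) (t + e n *s w) \<noteq> 0"
    unfolding e_def by (rule normal_product_pencil_eventually_nonzero[OF iso tr])
  have "(\<lambda>n. t + e n *s w) \<longlonglongrightarrow> t + 0 *s w"
    by (intro tendsto_intros tendsto_smult_vec e)
  then have L: "(\<lambda>n. t + e n *s w) \<longlonglongrightarrow> t" by simp
  have "(\<lambda>n. reflect_line (t + e n *s w) w) \<longlonglongrightarrow> reflect_line t w"
    unfolding reflect_line_def normal_product_def
    by (intro tendsto_intros tendsto_smult_vec L)
  moreover have lt: "reflect_line t w = (- 2 * normal_product t w) *s t"
    by (simp add: reflect_line_def iso vec_eq_iff)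
  ultimately have lim: "(\<lambda>n. reflect_line (t + e n *s w) w) \<longlonglongrightarrow> (- 2 * normal_product t w) *s t"
    by simp
  have ninf: "proj t \<noteq> line_at_infinity"
    using tr nz by (auto simp: proj_eq_line_at_infinity_iff normal_product_def)
  have inc': "(\<Sum>i\<in>UNIV. v $ i * (t + c *s w) $ i) = 0" for c
  proof -
    have "(\<Sum>i\<in>UNIV. v $ i * (t + c *s w) $ i)
        = (\<Sum>i\<in>UNIV. v $ i * t $ i) + c * (\<Sum>i\<in>UNIV. v $ i * w $ i)"
      by (simp add: sum_3 algebra_simps)
    then show ?thesis by (simp add: inc)
  qed
  have approx: "\<forall>\<^sub>F n in sequentially.
      (\<Sum>i\<in>UNIV. v $ i * (t + e n *s w) $ i) = 0 \<and> (\<Sum>i\<in>UNIV. v $ i * w $ i) = 0 \<and>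
      normal_product (t + e n *s w) (t + e n *s w) \<noteq> 0 \<and>
      (\<exists>c. c \<noteq> 0 \<and> reflect_line (t + e n *s w) w = c *s reflect_line (t + e n *s w) w)"
    using nonzero
    by (rule eventually_mono)
      (intro conjI inc(2) inc' exI[of _ 1] one_neq_zero vector_smult_lid[symmetric])
  have "symmetric_lines_isotropic (proj t) (proj v) (proj w) (proj ((- 2 * normal_product t w) *s t))"
    by (rule symmetric_lines_isotropicI[OF _ _ _ _ _ _ L tendsto_const lim tendsto_const approx])
      (use nz iso tr ninf in \<open>simp_all add: isotropic_proj_iff\<close>)
  moreover have "proj ((- 2 * normal_product t w) *s t) = proj t"
    by (rule proj_smult) (use tr nz in auto)
  ultimately show ?thesis by simp
qed

text \<open>Each approximating line is its own reflection, so it suffices to approximate \<open>t\<close> by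
  non-isotropic lines. They cannot in general be taken through \<open>v\<close>: if \<open>v\<close> is a circular point, all
  lines through it are isotropic. So the points have to move as well.\<close>

lemma isotropic_line_symmetric_to_itself:
  assumes nz: "t \<noteq> 0" "v \<noteq> 0"
    and iso: "normal_product t t = 0" and ninf: "proj t \<noteq> line_at_infinity"
    and inc: "(\<Sum>i\<in>UNIV. v $ i * t $ i) = 0"
  shows "symmetric_lines_isotropic (proj t) (proj v) (proj t) (proj t)"
proof -
  \<comment> \<open>The complex conjugate of \<open>t\<close> pairs with \<open>t\<close> to a sum of squared moduli, so it serves both as the
    direction of the pencil and as a point off \<open>t\<close>.\<close>
  define m :: "complex^3" where "m = (\<chi> i. cnj (t $ i))"
  define pair :: "complex^3 \<Rightarrow> complex^3 \<Rightarrow> complex" where "pair x y = (\<Sum>i\<in>UNIV. x $ i * y $ i)" for x y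
  have sq: "z * cnj z = complex_of_real ((cmod z)\<^sup>2)" for z
    by (rule complex_norm_square[symmetric])
  have tm: "normal_product t m \<noteq> 0"
  proof
    assume "normal_product t m = 0"
    then have "complex_of_real ((cmod (t $ 1))\<^sup>2 + (cmod (t $ 2))\<^sup>2) = 0"
      by (simp only: normal_product_def m_def vec_lambda_beta sq of_real_add)
    then have "(cmod (t $ 1))\<^sup>2 + (cmod (t $ 2))\<^sup>2 = 0" by (simp only: of_real_eq_0_iff)
    then have "t $ 1 = 0 \<and> t $ 2 = 0" by simp
    then show False using ninf nz by (simp add: proj_eq_line_at_infinity_iff)
  qed
  have pm: "pair m t \<noteq> 0"
  proof
    assume "pair m t = 0"
    then have "complex_of_real ((cmod (t $ 1))\<^sup>2 + (cmod (t $ 2))\<^sup>2 + (cmod (t $ 3))\<^sup>2) = 0"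
      by (simp only: pair_def sum_3 m_def vec_lambda_beta sq of_real_add mult.commute[of "cnj _"])
    then have "(cmod (t $ 1))\<^sup>2 + (cmod (t $ 2))\<^sup>2 + (cmod (t $ 3))\<^sup>2 = 0"
      by (simp only: of_real_eq_0_iff)
    then have "t $ 1 = 0 \<and> t $ 2 = 0 \<and> t $ 3 = 0"
      by (simp add: add_nonneg_eq_0_iff)
    then show False using nz by (simp add: vec3_nonzero_iff)
  qed
  define e where "e n = complex_of_real (inverse (real (Suc n)))" for n
  define L where "L n = t + e n *s m" for n
  \<comment> \<open>\<open>P n\<close> is the intersection of \<open>L n\<close> with the line joining \<open>v\<close> and \<open>m\<close>. Since \<open>v\<close> is on \<open>t\<close> and \<open>m\<close> is
    not, it tends to a nonzero multiple of \<open>v\<close>.\<close>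
  define P where "P n = pair m (L n) *s v - pair v (L n) *s m" for n
  have e: "e \<longlonglongrightarrow> 0" unfolding e_def by (rule tendsto_complex_inverse_Suc)
  have nonzero: "\<forall>\<^sub>F n in sequentially. normal_product (L n) (L n) \<noteq> 0"
    unfolding e_def L_def by (rule normal_product_pencil_eventually_nonzero[OF iso tm])
  have "L \<longlonglongrightarrow> t + 0 *s m" unfolding L_def
    by (intro tendsto_intros tendsto_smult_vec e)
  then have L: "L \<longlonglongrightarrow> t" by simp
  have "P \<longlonglongrightarrow> pair m t *s v - pair v t *s m"
    unfolding P_def pair_def by (intro tendsto_intros tendsto_smult_vec L)
  then have P: "P \<longlonglongrightarrow> pair m t *s v" using inc by (simp add: pair_def)
  have PL: "(\<Sum>i\<in>UNIV. P n $ i * L n $ i) = 0" for n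
  proof -
    have "(\<Sum>i\<in>UNIV. P n $ i * L n $ i) = pair m (L n) * pair v (L n) - pair v (L n) * pair m (L n)"
      by (simp add: P_def pair_def sum_3 algebra_simps)
    then show ?thesis by simp
  qed
  have refl: "reflect_line (L n) (L n) = (- normal_product (L n) (L n)) *s L n" for n
    by (simp add: reflect_line_def vec_eq_iff algebra_simps)
  have approx: "\<forall>\<^sub>F n in sequentially.
      (\<Sum>i\<in>UNIV. P n $ i * L n $ i) = 0 \<and> (\<Sum>i\<in>UNIV. P n $ i * L n $ i) = 0 \<and>
      normal_product (L n) (L n) \<noteq> 0 \<and> (\<exists>c. c \<noteq> 0 \<and> reflect_line (L n) (L n) = c *s L n)"
    using nonzero
  proof (rule eventually_mono)
    fix n assume N: "normal_product (L n) (L n) \<noteq> 0"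
    then have "- normal_product (L n) (L n) \<noteq> 0" by simp
    then show "(\<Sum>i\<in>UNIV. P n $ i * L n $ i) = 0 \<and>
        (\<Sum>i\<in>UNIV. P n $ i * L n $ i) = 0 \<and> normal_product (L n) (L n) \<noteq> 0 \<and>
        (\<exists>c. c \<noteq> 0 \<and> reflect_line (L n) (L n) = c *s L n)"
      by (intro conjI PL N exI[of _ "- normal_product (L n) (L n)"] refl)
  qed
  have "symmetric_lines_isotropic (proj t) (proj (pair m t *s v)) (proj t) (proj t)"
    by (rule symmetric_lines_isotropicI[OF _ _ _ _ _ _ L L L P approx])
      (use nz iso ninf pm in \<open>simp_all add: isotropic_proj_iff\<close>)
  then show ?thesis using pm nz by (simp add: proj_smult)
qed


section \<open>Tangents of confocal conics\<close>

lemma central_conic_mult: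
  "central_conic \<alpha> \<beta> *v v = vector [v $ 1 / \<alpha>, v $ 2 / \<beta>, - v $ 3]"
  by (simp add: central_conic_def vec_eq_iff forall_3 matrix_vector_mult_def sum_3)

lemma on_conic_proj:
  assumes "v \<noteq> 0"
  shows "on_conic (proj v) (central_conic \<alpha> \<beta>) \<longleftrightarrow> (v $ 1)\<^sup>2 / \<alpha> + (v $ 2)\<^sup>2 / \<beta> = (v $ 3)\<^sup>2"
  using assms
  by (subst on_conic.abs_eq)
    (auto simp: proportional_refl central_conic_mult sum_3 power2_eq_square)

text \<open>The bilinear form of the dual conic, whose null vectors are the tangent lines.\<close>

definition dual_form :: "complex \<Rightarrow> complex \<Rightarrow> complex^3 \<Rightarrow> complex^3 \<Rightarrow> complex" where
  "dual_form \<alpha> \<beta> u w = \<alpha> * u $ 1 * w $ 1 + \<beta> * u $ 2 * w $ 2 - u $ 3 * w $ 3"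

lemma tangent_to_central_conic_iff:
  assumes "\<alpha> \<noteq> 0" "\<beta> \<noteq> 0"
  shows "tangent_to l (central_conic \<alpha> \<beta>) \<longleftrightarrow>
    (\<exists>w. w \<noteq> 0 \<and> l = proj w \<and> dual_form \<alpha> \<beta> w w = 0)"
proof
  assume "tangent_to l (central_conic \<alpha> \<beta>)"
  then obtain p where p: "on_conic p (central_conic \<alpha> \<beta>)" "l = tangent_line (central_conic \<alpha> \<beta>) p"
    by (auto simp: tangent_to_def)
  obtain v where v: "p = proj v" "v \<noteq> 0" by (rule proj_cases)
  let ?w = "vector [v $ 1 / \<alpha>, v $ 2 / \<beta>, - v $ 3] :: complex^3"
  have "l = proj ?w"
    using p v assms by (simp add: tangent_line_proj conic_central_conic central_conic_mult)
  moreover have "?w \<noteq> 0" using v assms by (simp add: vector3_nonzero vec3_nonzero_iff)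
  moreover have "dual_form \<alpha> \<beta> ?w ?w = 0"
    using p v assms by (simp add: on_conic_proj dual_form_def power2_eq_square)
  ultimately show "\<exists>w. w \<noteq> 0 \<and> l = proj w \<and> dual_form \<alpha> \<beta> w w = 0" by blast
next
  assume "\<exists>w. w \<noteq> 0 \<and> l = proj w \<and> dual_form \<alpha> \<beta> w w = 0"
  then obtain w where w: "w \<noteq> 0" "l = proj w" "dual_form \<alpha> \<beta> w w = 0" by blast
  define v :: "complex^3" where "v = vector [\<alpha> * w $ 1, \<beta> * w $ 2, - w $ 3]"
  have v: "v \<noteq> 0" using w assms by (simp add: v_def vector3_nonzero vec3_nonzero_iff)
  have "central_conic \<alpha> \<beta> *v v = w"
    using assms by (simp add: central_conic_mult v_def vec_eq_iff forall_3)
  then have "l = tangent_line (central_conic \<alpha> \<beta>) (proj v)"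
    using w v assms by (simp add: tangent_line_proj conic_central_conic)
  moreover have "on_conic (proj v) (central_conic \<alpha> \<beta>)"
    using w v assms by (simp add: on_conic_proj dual_form_def v_def power2_eq_square algebra_simps)
  ultimately show "tangent_to l (central_conic \<alpha> \<beta>)" by (auto simp: tangent_to_def)
qed

lemma dual_form_confocal:
  "dual_form (\<alpha> - \<mu>) (\<beta> - \<mu>) u w = dual_form \<alpha> \<beta> u w - \<mu> * normal_product u w"
  by (simp add: dual_form_def normal_product_def algebra_simps)

lemma dual_form_reflect_line:
  "dual_form \<alpha> \<beta> (reflect_line t w) (reflect_line t w) =
     (normal_product t t)\<^sup>2 * dual_form \<alpha> \<beta> w w
     - 4 * normal_product t t * normal_product t w * dual_form \<alpha> \<beta> t w
     + 4 * (normal_product t w)\<^sup>2 * dual_form \<alpha> \<beta> t t"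
proof -
  have "dual_form \<alpha> \<beta> (x *s w - y *s t) (x *s w - y *s t) =
      x\<^sup>2 * dual_form \<alpha> \<beta> w w - 2 * x * y * dual_form \<alpha> \<beta> t w + y\<^sup>2 * dual_form \<alpha> \<beta> t t" for x y
    by (simp add: dual_form_def power2_eq_square algebra_simps)
  then show ?thesis by (simp add: reflect_line_def power2_eq_square)
qed

text \<open>The parameters of the conic may be complex: the argument is algebraic except for the limits at
  isotropic tangents, and these do not depend on the conic.\<close>

theorem confocal_conic_complex_caustic:
  assumes nz: "\<alpha> \<noteq> 0" "\<beta> \<noteq> 0" "\<mu> \<noteq> \<alpha>" "\<mu> \<noteq> \<beta>"
  shows "complex_caustic (central_conic (\<alpha> - \<mu>) (\<beta> - \<mu>)) (central_conic \<alpha> \<beta>)"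
  unfolding complex_caustic_def
proof (intro conjI allI impI)
  let ?C = "central_conic \<alpha> \<beta>" and ?C' = "central_conic (\<alpha> - \<mu>) (\<beta> - \<mu>)"
  have nz': "\<alpha> - \<mu> \<noteq> 0" "\<beta> - \<mu> \<noteq> 0" using nz by auto
  show "conic ?C" "conic ?C'" using nz nz' by (auto intro: conic_central_conic)
  fix l p
  assume lp: "tangent_to l ?C' \<and> on_conic p ?C \<and> on_line p l"
  obtain w where w: "w \<noteq> 0" "l = proj w" and Fw: "dual_form (\<alpha> - \<mu>) (\<beta> - \<mu>) w w = 0"
    using lp tangent_to_central_conic_iff[OF nz'] by blast
  obtain v where v: "p = proj v" "v \<noteq> 0" by (rule proj_cases)
  define t where "t = ?C *v v"
  have t_eq: "t = vector [v $ 1 / \<alpha>, v $ 2 / \<beta>, - v $ 3]" by (simp add: t_def central_conic_mult)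
  have t: "t \<noteq> 0" using v nz by (simp add: t_eq vector3_nonzero vec3_nonzero_iff)
  have T: "tangent_line ?C p = proj t"
    using v nz by (simp add: tangent_line_proj conic_central_conic t_def)
  have vC: "(v $ 1)\<^sup>2 / \<alpha> + (v $ 2)\<^sup>2 / \<beta> = (v $ 3)\<^sup>2" using lp v by (simp add: on_conic_proj)
  have vw: "(\<Sum>i\<in>UNIV. v $ i * w $ i) = 0" using lp v w by (simp add: on_line_proj)
  have vt: "(\<Sum>i\<in>UNIV. v $ i * t $ i) = 0"
    using vC by (simp add: sum_3 t_eq power2_eq_square)
  \<comment> \<open>Polarity: \<open>t\<close> is the image of \<open>v\<close> under the matrix inverse to that of the dual form.\<close>
  have "dual_form \<alpha> \<beta> t x = (\<Sum>i\<in>UNIV. v $ i * x $ i)" for x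
    using nz by (simp add: dual_form_def t_eq sum_3)
  then have Ft: "dual_form (\<alpha> - \<mu>) (\<beta> - \<mu>) t t = - \<mu> * normal_product t t"
    and Ftw: "dual_form (\<alpha> - \<mu>) (\<beta> - \<mu>) t w = - \<mu> * normal_product t w"
    using vt vw by (simp_all add: dual_form_confocal)
  have on: "on_line p (proj t)" "on_line p l" using v t vt lp by (simp_all add: on_line_proj)
  show "\<exists>l'. tangent_to l' ?C' \<and> reflected ?C p l l'"
  proof (cases "normal_product t t = 0")
    case False
    define w' where "w' = reflect_line t w"
    have w': "w' \<noteq> 0" using False w by (simp add: w'_def reflect_line_nonzero)
    have "dual_form (\<alpha> - \<mu>) (\<beta> - \<mu>) w' w' = 0"
      by (simp add: w'_def dual_form_reflect_line Fw Ft Ftw power2_eq_square)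
    then have "tangent_to (proj w') ?C'"
      using w' tangent_to_central_conic_iff[OF nz'] by blast
    moreover have "(\<Sum>i\<in>UNIV. v $ i * w' $ i)
       = normal_product t t * (\<Sum>i\<in>UNIV. v $ i * w $ i)
         - 2 * normal_product t w * (\<Sum>i\<in>UNIV. v $ i * t $ i)"
      by (simp add: w'_def reflect_line_def sum_3 algebra_simps)
    then have "on_line p (proj w')" using v w' vw vt by (simp add: on_line_proj)
    moreover have "symmetric_lines_nonisotropic (proj t) l (proj w')"
      unfolding w(2) w'_def by (rule symmetric_lines_reflect_line[OF t False w(1)])
    ultimately show ?thesis
      using on lp False t
      by (auto simp: reflected_def symmetric_lines_def T isotropic_proj_iff)
  next
    case True
    have "tangent_to (proj t) ?C'"
      using t Ft True tangent_to_central_conic_iff[OF nz'] by auto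
    moreover have "symmetric_lines_isotropic (proj t) (proj v) (proj w) (proj t)"
    proof (cases "normal_product t w = 0")
      case False
      then show ?thesis
        by (rule isotropic_line_symmetric_to_transversal[OF t w(1) v(2) True _ vt vw])
    next
      case parallel: True
      have finite: "t $ 1 \<noteq> 0 \<or> t $ 2 \<noteq> 0"
        using v vC nz by (auto simp: t_eq vec3_nonzero_iff)
      then have tn: "t $ 1 \<noteq> 0" "t $ 2 \<noteq> 0"
        using True by (auto simp: normal_product_def)
      \<comment> \<open>The orthogonal complement of an isotropic vector in the plane is the line it spans, so
        the first two coordinates of \<open>w\<close> are \<open>s\<close> times those of \<open>t\<close>. Then \<open>w - s t\<close> has only a third
        coordinate, and evaluating the dual form on it shows that this vanishes.\<close>
      define s where "s = w $ 1 / t $ 1"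
      have w1: "w $ 1 = s * t $ 1" using tn by (simp add: s_def)
      have "t $ 2 * (w $ 2 - s * t $ 2) = normal_product t w - s * normal_product t t"
        by (simp add: normal_product_def w1 algebra_simps)
      then have w2: "w $ 2 = s * t $ 2" using tn True parallel by simp
      have "dual_form (\<alpha> - \<mu>) (\<beta> - \<mu>) w w - 2 * s * dual_form (\<alpha> - \<mu>) (\<beta> - \<mu>) t w
          + s\<^sup>2 * dual_form (\<alpha> - \<mu>) (\<beta> - \<mu>) t t = - (w $ 3 - s * t $ 3)\<^sup>2"
        by (simp add: dual_form_def w1 w2 power2_eq_square algebra_simps)
      then have "w $ 3 = s * t $ 3" by (simp add: Fw Ft Ftw True parallel)
      then have ws: "w = s *s t" by (simp add: vec_eq_iff forall_3 w1 w2)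
      then have "s \<noteq> 0" using w by auto
      then have "proj w = proj t" unfolding ws using t by (rule proj_smult)
      moreover have "proj t \<noteq> line_at_infinity" using finite t by (simp add: proj_eq_line_at_infinity_iff)
      ultimately show ?thesis
        using isotropic_line_symmetric_to_itself[OF t v(2) True _ vt] by simp
    qed
    ultimately show ?thesis
      using on lp True t unfolding v(1)[symmetric] w(2)[symmetric]
      by (auto simp: reflected_def symmetric_lines_def T isotropic_proj_iff)
  qed
qed

theorem proposition2p18:
  fixes a b :: real and lam :: complex
  assumes "a \<noteq> 0" and "b \<noteq> 0"
    and "lam \<noteq> complex_of_real a" and "lam \<noteq> complex_of_real b"
  shows "complex_caustic
    (central_conic (complex_of_real a - lam) (complex_of_real b - lam))
    (central_conic (complex_of_real a) (complex_of_real b))"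
  using assms by (intro confocal_conic_complex_caustic) auto

end
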